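(* Every spin factor $J$ has the density property; that is, for any $x,y\in J$ and $\varepsilon>0$, there exists $z\in J$ with $\|z\|<\varepsilon$ such that $B(x,y+z)$ is invertible.
   Context: A spin factor $J$ is a complex Hilbert space with inner product $\langle\cdot,\cdot\rangle$ (linear in the first variable), equipped with a conjugation $j:J\to J$ ($j$ is conjugate linear, $\langle jx,jy\rangle=\overline{\langle x,y\rangle}$, $j^2=I$), given the equivalent norm $\|x\|^2=\langle x,x\rangle+\sqrt{\langle x,x\rangle^2-|\langle x,jx\rangle|^2}$ and the triple product $\{a,b,c\}=\langle a,b\rangle c+\langle c,b\rangle a-\langle a,jc\rangle jb$. For $x,y\in J$ the Bergmann operator is the bounded complex linear operator $B(x,y)=I-2D(x,y)+Q_xQ_y$ on $J$, where $D(x,y)z=\{x,y,z\}$ and $Q_xz=\{x,z,x\}$; that is, $B(x,y)z=z-2\{x,y,z\}+\{x,\{y,z,y\},x\}$. *)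

theory Defs
  imports "HOL-Analysis.Analysis"
begin

text \<open>
  The complex inner product is linear in the first variable. The carrier type is only required to
  be an abelian group, so that it carries neither a norm nor a topology of its own: the Hilbert
  norm and the spin norm are two different (equivalent) norms on the same space.
\<close>

locale complex_inner_product_space = vector_space scale
  for scale :: "complex \<Rightarrow> 'a::ab_group_add \<Rightarrow> 'a" +
  fixes cinner :: "'a \<Rightarrow> 'a \<Rightarrow> complex"
  assumes cinner_add_left: "cinner (x + y) z = cinner x z + cinner y z"
    and cinner_scale_left: "cinner (scale c x) y = c * cinner x y"
    and cinner_commute: "cinner y x = cnj (cinner x y)"
    and cinner_ge_zero: "Re (cinner x x) \<ge> 0"
    and cinner_eq_zero_iff: "cinner x x = 0 \<longleftrightarrow> x = 0"
begin

definition hilbert_norm :: "'a \<Rightarrow> real" where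
  "hilbert_norm x = sqrt (Re (cinner x x))"

lemma cinner_add_right: "cinner x (y + z) = cinner x y + cinner x z"
  by (metis cinner_add_left cinner_commute complex_cnj_add)

lemma cinner_scale_right: "cinner x (scale c y) = cnj c * cinner x y"
  by (metis cinner_scale_left cinner_commute complex_cnj_mult)

lemma Re_cinner_commute: "Re (cinner y x) = Re (cinner x y)"
  by (subst cinner_commute) simp

lemma Im_cinner_self: "Im (cinner x x) = 0"
  using cinner_commute[of x x] by (simp add: complex_eq_iff)

lemma hilbert_norm_power2: "(hilbert_norm x)\<^sup>2 = Re (cinner x x)"
  by (simp add: hilbert_norm_def cinner_ge_zero)

lemma hilbert_norm_nonneg: "hilbert_norm x \<ge> 0"
  by (simp add: hilbert_norm_def cinner_ge_zero)

lemma hilbert_norm_eq_zero_iff: "hilbert_norm x = 0 \<longleftrightarrow> x = 0"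
  by (metis Im_cinner_self cinner_eq_zero_iff complex_eq_iff hilbert_norm_def
      real_sqrt_eq_zero_cancel_iff zero_complex.simps)

lemma hilbert_norm_minus: "hilbert_norm (- x) = hilbert_norm x"
proof -
  have "- x = scale (- 1) x"
    by (simp add: scale_minus_left)
  then show ?thesis
    by (simp add: hilbert_norm_def cinner_scale_left cinner_scale_right
        del: scale_minus_left)
qed

lemma Re_cinner_le: "Re (cinner x y) \<le> hilbert_norm x * hilbert_norm y"
proof (cases "y = 0")
  case True
  have "cinner x 0 = 0"
    using cinner_add_right[of x 0 0] by simp
  then show ?thesis
    using True by (simp add: hilbert_norm_nonneg)
next
  case False
  define p where "p = Re (cinner x y)"
  define n where "n = Re (cinner y y)"
  have n: "n > 0"
    using False hilbert_norm_eq_zero_iff[of y] cinner_ge_zero[of y]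
    by (auto simp: n_def hilbert_norm_def less_le)
  define u where "u = scale (of_real (- (p / n))) y"
  have "0 \<le> Re (cinner (x + u) (x + u))"
    by (rule cinner_ge_zero)
  also have "\<dots> = Re (cinner x x) - 2 * (p / n) * p + (p / n)\<^sup>2 * n"
    by (simp add: u_def cinner_add_left cinner_add_right cinner_scale_left cinner_scale_right
        Re_cinner_commute[of x y] p_def n_def power2_eq_square algebra_simps Im_cinner_self
        del: of_real_minus of_real_divide scale_minus_left)
  also have "\<dots> = Re (cinner x x) - p\<^sup>2 / n"
    using n by (simp add: field_simps power2_eq_square)
  finally have "p\<^sup>2 \<le> Re (cinner x x) * n"
    using n by (simp add: field_simps)
  then have "p\<^sup>2 \<le> (hilbert_norm x * hilbert_norm y)\<^sup>2"
    by (simp add: power_mult_distrib hilbert_norm_power2 n_def)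
  then show ?thesis
    unfolding p_def by (rule power2_le_imp_le) (simp add: hilbert_norm_nonneg)
qed

lemma hilbert_norm_triangle: "hilbert_norm (x + y) \<le> hilbert_norm x + hilbert_norm y"
proof (rule power2_le_imp_le)
  show "(hilbert_norm (x + y))\<^sup>2 \<le> (hilbert_norm x + hilbert_norm y)\<^sup>2"
    using Re_cinner_le[of x y]
    by (simp add: hilbert_norm_power2 power2_sum cinner_add_left cinner_add_right
        Re_cinner_commute[of x y])
qed (simp add: hilbert_norm_nonneg)

lemma Metric_space_hilbert_norm: "Metric_space UNIV (\<lambda>x y. hilbert_norm (x - y))"
proof
  show "hilbert_norm (x - y) = hilbert_norm (y - x)" for x y
    using hilbert_norm_minus[of "x - y"] by simp
  show "hilbert_norm (x - z) \<le> hilbert_norm (x - y) + hilbert_norm (y - z)" for x y z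
    using hilbert_norm_triangle[of "x - y" "y - z"] by simp
qed (simp_all add: hilbert_norm_nonneg hilbert_norm_eq_zero_iff)

end

locale complex_hilbert_space = complex_inner_product_space +
  assumes hilbert_complete: "Metric_space.mcomplete UNIV (\<lambda>x y. hilbert_norm (x - y))"

locale spin_factor = complex_hilbert_space scale cinner
  for scale :: "complex \<Rightarrow> 'a::ab_group_add \<Rightarrow> 'a"
    and cinner :: "'a \<Rightarrow> 'a \<Rightarrow> complex" +
  fixes j :: "'a \<Rightarrow> 'a"
  assumes conj_add: "j (x + y) = j x + j y"
    and conj_scale: "j (scale c x) = scale (cnj c) (j x)"
    and cinner_conj: "cinner (j x) (j y) = cnj (cinner x y)"
    and conj_conj: "j (j x) = x"
begin

text \<open>\<open>\<langle>x, x\<rangle>\<close> is real, so it is written as \<open>Re (cinner x x)\<close>; the argument of the inner square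
  root is nonnegative by the Cauchy--Schwarz inequality.\<close>

definition spin_norm :: "'a \<Rightarrow> real" where
  "spin_norm x =
     sqrt (Re (cinner x x) + sqrt ((Re (cinner x x))\<^sup>2 - (cmod (cinner x (j x)))\<^sup>2))"

definition triple :: "'a \<Rightarrow> 'a \<Rightarrow> 'a \<Rightarrow> 'a" where
  "triple a b c = scale (cinner a b) c + scale (cinner c b) a - scale (cinner a (j c)) (j b)"

definition D :: "'a \<Rightarrow> 'a \<Rightarrow> 'a \<Rightarrow> 'a" where
  "D x y = (\<lambda>z. triple x y z)"

definition Q :: "'a \<Rightarrow> 'a \<Rightarrow> 'a" where
  "Q x = (\<lambda>z. triple x z x)"

definition Bergmann :: "'a \<Rightarrow> 'a \<Rightarrow> 'a \<Rightarrow> 'a" where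
  "Bergmann x y = (\<lambda>z. z - scale 2 (D x y z) + Q x (Q y z))"

definition bounded_operator :: "('a \<Rightarrow> 'a) \<Rightarrow> bool" where
  "bounded_operator T \<longleftrightarrow>
     Vector_Spaces.linear scale scale T \<and> (\<exists>K. \<forall>x. spin_norm (T x) \<le> K * spin_norm x)"

text \<open>Invertibility in the algebra of bounded complex linear operators on the spin factor.\<close>

definition invertible_operator :: "('a \<Rightarrow> 'a) \<Rightarrow> bool" where
  "invertible_operator T \<longleftrightarrow>
     bounded_operator T \<and> (\<exists>S. bounded_operator S \<and> S \<circ> T = id \<and> T \<circ> S = id)"

end

end

theory Submission
  imports Defs
begin

text \<open>
  With \<open>q v = \<langle>v, jv\<rangle>\<close> and \<open>\<delta> = 1 - 2\<langle>x, y\<rangle> + q x * cnj (q y)\<close>, the operator \<open>B(x, y)\<close> equals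
  \<open>\<delta> I\<close> plus an operator with range in the span of \<open>x\<close> and \<open>jy\<close>. If \<open>\<delta> \<noteq> 0\<close>, an operator of the
  same shape inverts it. For real \<open>c\<close>, replacing \<open>y\<close> by \<open>c y\<close> turns \<open>\<delta>\<close> into a polynomial in \<open>c\<close>
  with constant term \<open>1\<close>, which has only finitely many zeros, so \<open>z = r y\<close> works for all but
  finitely many real \<open>r\<close>.
\<close>

section \<open>Rank-two perturbations of scalar operators on an inner product space\<close>

context complex_inner_product_space
begin

lemma hilbert_norm_scale: "hilbert_norm (scale c x) = cmod c * hilbert_norm x"
proof -
  have "cinner (scale c x) (scale c x) = of_real ((cmod c)\<^sup>2) * cinner x x"
    unfolding complex_norm_square by (simp add: cinner_scale_left cinner_scale_right)
  then show ?thesis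
    by (simp add: hilbert_norm_def real_sqrt_mult del: of_real_power)
qed

text \<open>Multiplying \<open>x\<close> by a suitable phase makes the pairing with \<open>y\<close>
  equal to its modulus and preserves the norm of \<open>x\<close>, so the bound on real parts
  applies.\<close>

lemma cmod_cinner_le: "cmod (cinner x y) \<le> hilbert_norm x * hilbert_norm y"
proof (cases "cinner x y = 0")
  case True
  then show ?thesis by (simp add: hilbert_norm_nonneg)
next
  case False
  define c where "c = cnj (cinner x y) / of_real (cmod (cinner x y))"
  have "cinner (scale c x) y = of_real (cmod (cinner x y))"
    using False
    by (simp add: c_def cinner_scale_left divide_simps mult.commute[of "cnj _"]
        power2_eq_square[symmetric] complex_norm_square[symmetric])
  moreover have "cmod c = 1"
    using False by (simp add: c_def norm_divide)
  ultimately show ?thesis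
    using Re_cinner_le[of "scale c x" y] by (simp add: hilbert_norm_scale)
qed

definition rank_two_update ::
  "'a \<Rightarrow> 'a \<Rightarrow> 'a \<Rightarrow> 'a \<Rightarrow> complex \<Rightarrow> complex \<Rightarrow> complex \<Rightarrow> complex \<Rightarrow> complex \<Rightarrow> 'a \<Rightarrow> 'a" where
  "rank_two_update v w f g d a11 a12 a21 a22 z =
     scale d z + scale (a11 * cinner z f + a12 * cinner z g) v
       + scale (a21 * cinner z f + a22 * cinner z g) w"

lemma linear_rank_two_update:
  "Vector_Spaces.linear scale scale (rank_two_update v w f g d a11 a12 a21 a22)"
  by unfold_locales
    (simp_all add: rank_two_update_def cinner_add_left cinner_scale_left algebra_simps)

lemma hilbert_norm_rank_two_update_le:
  "\<exists>K\<ge>0. \<forall>z. hilbert_norm (rank_two_update v w f g d a11 a12 a21 a22 z) \<le> K * hilbert_norm z"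
proof -
  have functional: "cmod (a * cinner z f + b * cinner z g)
      \<le> (cmod a * hilbert_norm f + cmod b * hilbert_norm g) * hilbert_norm z" for a b z
  proof -
    have "cmod (a * cinner z f + b * cinner z g)
        \<le> cmod a * cmod (cinner z f) + cmod b * cmod (cinner z g)"
      by (metis norm_mult norm_triangle_ineq)
    also have "\<dots> \<le> cmod a * (hilbert_norm z * hilbert_norm f)
        + cmod b * (hilbert_norm z * hilbert_norm g)"
      by (intro add_mono mult_left_mono cmod_cinner_le) auto
    finally show ?thesis by (simp add: algebra_simps)
  qed
  define K where "K = cmod d
    + (cmod a11 * hilbert_norm f + cmod a12 * hilbert_norm g) * hilbert_norm v
    + (cmod a21 * hilbert_norm f + cmod a22 * hilbert_norm g) * hilbert_norm w"
  have "hilbert_norm (rank_two_update v w f g d a11 a12 a21 a22 z) \<le> K * hilbert_norm z" for z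
  proof -
    have "hilbert_norm (rank_two_update v w f g d a11 a12 a21 a22 z)
        \<le> cmod d * hilbert_norm z
          + cmod (a11 * cinner z f + a12 * cinner z g) * hilbert_norm v
          + cmod (a21 * cinner z f + a22 * cinner z g) * hilbert_norm w"
      unfolding rank_two_update_def hilbert_norm_scale[symmetric]
      by (meson add_right_mono hilbert_norm_triangle order_trans)
    also have "\<dots> \<le> cmod d * hilbert_norm z
        + (cmod a11 * hilbert_norm f + cmod a12 * hilbert_norm g) * hilbert_norm z * hilbert_norm v
        + (cmod a21 * hilbert_norm f + cmod a22 * hilbert_norm g) * hilbert_norm z * hilbert_norm w"
      by (intro add_mono mult_right_mono functional order_refl hilbert_norm_nonneg)
    finally show ?thesis by (simp add: K_def algebra_simps)
  qed
  moreover have "K \<ge> 0"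
    by (simp add: K_def hilbert_norm_nonneg)
  ultimately show ?thesis by blast
qed

text \<open>With \<open>A\<close>, \<open>B\<close> the two coefficient matrices and
  \<open>G\<close> the matrix of pairings of \<open>v\<close>, \<open>w\<close> with
  \<open>f\<close>, \<open>g\<close>, the composite has scalar part \<open>d * e\<close> and matrix
  \<open>d B + e A + A G B\<close>. The last four assumptions say that this matrix vanishes.\<close>

lemma rank_two_update_comp_eq_id:
  assumes "d * e = 1"
    and "d * b11 + a11 * e + a11 * (cinner v f * b11 + cinner w f * b21)
           + a12 * (cinner v g * b11 + cinner w g * b21) = 0"
    and "d * b12 + a12 * e + a11 * (cinner v f * b12 + cinner w f * b22)
           + a12 * (cinner v g * b12 + cinner w g * b22) = 0"
    and "d * b21 + a21 * e + a21 * (cinner v f * b11 + cinner w f * b21)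
           + a22 * (cinner v g * b11 + cinner w g * b21) = 0"
    and "d * b22 + a22 * e + a21 * (cinner v f * b12 + cinner w f * b22)
           + a22 * (cinner v g * b12 + cinner w g * b22) = 0"
  shows "rank_two_update v w f g d a11 a12 a21 a22 \<circ> rank_two_update v w f g e b11 b12 b21 b22 = id"
proof
  fix z
  define T where "T = rank_two_update v w f g e b11 b12 b21 b22 z"
  define m where "m = b11 * cinner z f + b12 * cinner z g"
  define n where "n = b21 * cinner z f + b22 * cinner z g"
  have T: "T = scale e z + scale m v + scale n w"
    by (simp add: T_def m_def n_def rank_two_update_def)
  have pairing: "cinner T h = e * cinner z h + m * cinner v h + n * cinner w h" for h
    by (simp add: T cinner_add_left cinner_scale_left)
  have "rank_two_update v w f g d a11 a12 a21 a22 T = scale (d * e) z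
      + scale (d * m + (a11 * cinner T f + a12 * cinner T g)) v
      + scale (d * n + (a21 * cinner T f + a22 * cinner T g)) w"
    unfolding rank_two_update_def
    by (subst (1) T) (simp add: scale_left_distrib scale_right_distrib add_ac)
  moreover have "d * m + (a11 * cinner T f + a12 * cinner T g) = 0"
  proof -
    have "d * m + (a11 * cinner T f + a12 * cinner T g)
        = (d * b11 + a11 * e + a11 * (cinner v f * b11 + cinner w f * b21)
           + a12 * (cinner v g * b11 + cinner w g * b21)) * cinner z f
        + (d * b12 + a12 * e + a11 * (cinner v f * b12 + cinner w f * b22)
           + a12 * (cinner v g * b12 + cinner w g * b22)) * cinner z g"
      by (simp only: pairing m_def n_def ring_distribs ac_simps)
    then show ?thesis using assms(2,3) by simp
  qed
  moreover have "d * n + (a21 * cinner T f + a22 * cinner T g) = 0"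
  proof -
    have "d * n + (a21 * cinner T f + a22 * cinner T g)
        = (d * b21 + a21 * e + a21 * (cinner v f * b11 + cinner w f * b21)
           + a22 * (cinner v g * b11 + cinner w g * b21)) * cinner z f
        + (d * b22 + a22 * e + a21 * (cinner v f * b12 + cinner w f * b22)
           + a22 * (cinner v g * b12 + cinner w g * b22)) * cinner z g"
      by (simp only: pairing m_def n_def ring_distribs ac_simps)
    then show ?thesis using assms(4,5) by simp
  qed
  ultimately show "(rank_two_update v w f g d a11 a12 a21 a22
      \<circ> rank_two_update v w f g e b11 b12 b21 b22) z = id z"
    by (simp add: T_def[symmetric] assms(1))
qed

end

section \<open>Spin factors: norm comparison, Bergmann operators and density\<close>

context spin_factor
begin

lemma cinner_j_right: "cinner x (j y) = cinner y (j x)"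
  by (metis cinner_conj cinner_commute conj_conj)

lemma hilbert_norm_j: "hilbert_norm (j x) = hilbert_norm x"
  by (simp add: hilbert_norm_def cinner_conj)

text \<open>Cauchy-Schwarz, as \<open>j\<close> preserves the Hilbert norm. It makes the inner
  radicand of \<open>spin_norm\<close> nonnegative.\<close>

lemma cmod_cinner_j_le: "(cmod (cinner x (j x)))\<^sup>2 \<le> (Re (cinner x x))\<^sup>2"
  using cmod_cinner_le[of x "j x"]
  by (intro power_mono) (simp_all add: hilbert_norm_j flip: hilbert_norm_power2 power2_eq_square)

lemma hilbert_norm_le_spin_norm: "hilbert_norm x \<le> spin_norm x"
  using cmod_cinner_j_le[of x] by (simp add: hilbert_norm_def spin_norm_def)

lemma spin_norm_le_hilbert_norm: "spin_norm x \<le> sqrt 2 * hilbert_norm x"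
proof -
  have "sqrt ((Re (cinner x x))\<^sup>2 - (cmod (cinner x (j x)))\<^sup>2) \<le> Re (cinner x x)"
    by (rule real_le_lsqrt) (simp_all add: cinner_ge_zero)
  then show ?thesis
    by (simp add: spin_norm_def hilbert_norm_def flip: real_sqrt_mult)
qed

text \<open>Boundedness refers to \<open>spin_norm\<close>; the two norm comparisons transfer the
  Hilbert bound at the cost of a factor \<open>sqrt 2\<close>.\<close>

lemma bounded_operator_rank_two_update:
  "bounded_operator (rank_two_update v w f g d a11 a12 a21 a22)"
proof -
  define T where "T = rank_two_update v w f g d a11 a12 a21 a22"
  obtain K where K: "K \<ge> 0" "\<And>z. hilbert_norm (T z) \<le> K * hilbert_norm z"
    unfolding T_def using hilbert_norm_rank_two_update_le by blast
  have "spin_norm (T z) \<le> (sqrt 2 * K) * spin_norm z" for z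
  proof -
    have "spin_norm (T z) \<le> sqrt 2 * hilbert_norm (T z)"
      by (rule spin_norm_le_hilbert_norm)
    also have "\<dots> \<le> sqrt 2 * (K * spin_norm z)"
      using K(2)[of z] mult_left_mono[OF hilbert_norm_le_spin_norm[of z] K(1)]
      by (intro mult_left_mono) auto
    finally show ?thesis by simp
  qed
  then show ?thesis
    unfolding bounded_operator_def T_def using linear_rank_two_update by blast
qed

text \<open>This is the scalar \<delta> of the overview: \<open>cinner (j y) y\<close> is the
  conjugate of \<open>cinner y (j y)\<close>.\<close>

definition generic_norm :: "'a \<Rightarrow> 'a \<Rightarrow> complex" where
  "generic_norm x y = 1 - 2 * cinner x y + cinner x (j x) * cinner (j y) y"

text \<open>\<open>j (Q y z)\<close> is a combination of \<open>j y\<close> and \<open>z\<close>,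
  and \<open>cinner x (Q y z)\<close> one of \<open>cinner z y\<close> and
  \<open>cinner z (j x)\<close>. Collecting the multiples of \<open>z\<close> gives
  \<open>generic_norm x y\<close>; the rest are multiples of \<open>x\<close> and
  \<open>j y\<close>.\<close>

lemma Bergmann_eq_rank_two_update:
  "Bergmann x y = rank_two_update x (j y) y (j x) (generic_norm x y)
     (4 * cinner x y - 2) (- 2 * cinner (j y) y) (- 2 * cinner x (j x)) 2"
proof
  fix z
  have j_minus: "j (- v) = - j v" for v
    using conj_scale[of "-1" v] by simp
  have j_diff: "j (v - w) = j v - j w" for v w
    using conj_add[of v "- w"] by (simp add: j_minus)
  have right_diff: "cinner v (w - w') = cinner v w - cinner v w'" for v w w'
    using cinner_add_right[of v "w - w'" w'] by simp
  have Qz: "Q v w = scale (2 * cinner v w) v - scale (cinner v (j v)) (j w)" for v w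
    unfolding Q_def triple_def mult_2 scale_left_distrib ..
  have c1: "cnj (cinner y z) = cinner z y" "cnj (cinner y (j y)) = cinner (j y) y"
    by (simp_all flip: cinner_commute)
  have jQ: "j (Q y z) = scale (2 * cinner z y) (j y) - scale (cinner (j y) y) z"
    by (simp add: Qz j_diff conj_scale conj_conj c1)
  have xQ: "cinner x (Q y z) = 2 * cinner z y * cinner x y - cinner (j y) y * cinner z (j x)"
    by (simp add: Qz right_diff cinner_scale_right c1 cinner_j_right[of x z])
  have "Bergmann x y z = z - scale 2 (scale (cinner x y) z + scale (cinner z y) x
        - scale (cinner z (j x)) (j y))
      + (scale (2 * (2 * cinner z y * cinner x y - cinner (j y) y * cinner z (j x))) x
        - scale (cinner x (j x)) (scale (2 * cinner z y) (j y) - scale (cinner (j y) y) z))"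
    by (simp only: Bergmann_def Qz[of x "Q y z"] xQ jQ)
      (simp add: D_def triple_def cinner_j_right[of x z])
  also have "\<dots> = rank_two_update x (j y) y (j x) (generic_norm x y)
     (4 * cinner x y - 2) (- 2 * cinner (j y) y) (- 2 * cinner x (j x)) 2 z"
    by (simp add: rank_two_update_def generic_norm_def algebra_simps)
  finally show "Bergmann x y z = rank_two_update x (j y) y (j x) (generic_norm x y)
     (4 * cinner x y - 2) (- 2 * cinner (j y) y) (- 2 * cinner x (j x)) 2 z" .
qed

lemma invertible_operator_Bergmann:
  assumes "generic_norm x y \<noteq> 0"
  shows "invertible_operator (Bergmann x y)"
proof -
  define u s t d where "u = cinner x y" and "s = cinner x (j x)" and "t = cinner (j y) y"
    and "d = generic_norm x y"
  have d: "d = 1 - 2 * u + s * t"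
    by (simp add: d_def generic_norm_def u_def s_def t_def)
  have u': "cinner (j y) (j x) = u"
    unfolding u_def by (metis cinner_conj cinner_commute)
  define i where "i = inverse d"
  have i: "d * i = 1"
    using assms by (simp add: d_def i_def)
  \<comment> \<open>The matrix solves \<open>d B + i A + A G B = 0\<close> for \<open>B\<close>,
    where \<open>A\<close> is the matrix of the Bergmann operator and \<open>G\<close> has rows
    \<open>u, t\<close> and \<open>s, u\<close>. Since \<open>d I + A G\<close> has determinant
    \<open>d\<^sup>2\<close>, the solution is \<open>i\<^sup>2\<close> times \<open>A\<close> with
    its diagonal entries exchanged.\<close>
  define S where "S = rank_two_update x (j y) y (j x) i
    (2 * i\<^sup>2) (- 2 * t * i\<^sup>2) (- 2 * s * i\<^sup>2) ((4 * u - 2) * i\<^sup>2)"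
  have B: "Bergmann x y = rank_two_update x (j y) y (j x) d (4 * u - 2) (- 2 * t) (- 2 * s) 2"
    unfolding Bergmann_eq_rank_two_update u_def s_def t_def d_def ..
  note pairings = u' u_def[symmetric] s_def[symmetric] t_def[symmetric]
  \<comment> \<open>Each condition is a polynomial identity in \<open>u\<close>, \<open>s\<close>,
    \<open>t\<close>, \<open>d\<close>, \<open>i\<close> modulo \<open>d * i = 1\<close> and the
    formula for \<open>d\<close>. The other composition is checked as well, since the space may be
    infinite-dimensional.\<close>
  have "Bergmann x y \<circ> S = id"
    unfolding B S_def
    by (rule rank_two_update_comp_eq_id; (unfold pairings)?; use i d in algebra)
  moreover have "S \<circ> Bergmann x y = id"
    unfolding B S_def
    by (rule rank_two_update_comp_eq_id; (unfold pairings)?; use i d in algebra)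
  moreover have "bounded_operator (Bergmann x y)" "bounded_operator S"
    unfolding B S_def by (rule bounded_operator_rank_two_update)+
  ultimately show ?thesis
    unfolding invertible_operator_def by blast
qed

lemma finite_generic_norm_scale_eq_0: "finite {r::real. generic_norm x (scale (of_real r) y) = 0}"
proof -
  define p where "p = [:1, - 2 * cinner x y, cinner x (j x) * cinner (j y) y:]"
  have "generic_norm x (scale (of_real r) y) = poly p (of_real r)" for r
    by (simp add: p_def generic_norm_def cinner_scale_left cinner_scale_right conj_scale
        algebra_simps)
  \<comment> \<open>The constant coefficient 1 ensures that \<open>p\<close> is nonzero; its
    finitely many complex roots have a finite preimage under the injection
    \<open>of_real\<close>.\<close>
  moreover have "finite {r::real. poly p (of_real r) = 0}"
    using finite_vimageI[OF poly_roots_finite[of p], of of_real]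
    by (simp add: p_def vimage_def inj_of_real)
  ultimately show ?thesis by simp
qed

lemma density_property:
  assumes "\<epsilon> > 0"
  shows "\<exists>z. spin_norm z < \<epsilon> \<and> invertible_operator (Bergmann x (y + z))"
proof -
  \<comment> \<open>Chosen so that \<open>r - 1 < \<eta>\<close> forces
    \<open>spin_norm z < \<epsilon>\<close> below; the summand 1 keeps the denominator positive when
    \<open>y = 0\<close>.\<close>
  define \<eta> where "\<eta> = \<epsilon> / (sqrt 2 * (hilbert_norm y + 1))"
  have pos: "sqrt 2 * (hilbert_norm y + 1) > 0"
    using hilbert_norm_nonneg[of y] by simp
  then have "\<eta> > 0"
    using assms by (simp add: \<eta>_def)
  then have "infinite ({1<..<1 + \<eta>} - {r::real. generic_norm x (scale (of_real r) y) = 0})"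
    by (intro Diff_infinite_finite finite_generic_norm_scale_eq_0) simp
  then have "{1<..<1 + \<eta>} - {r::real. generic_norm x (scale (of_real r) y) = 0} \<noteq> {}"
    by (rule infinite_imp_nonempty)
  then obtain r where "r \<in> {1<..<1 + \<eta>} - {r. generic_norm x (scale (of_real r) y) = 0}"
    unfolding ex_in_conv[symmetric] ..
  then have r: "1 < r" "r < 1 + \<eta>" "generic_norm x (scale (of_real r) y) \<noteq> 0"
    by simp_all
  \<comment> \<open>The factor is \<open>r - 1\<close> because \<open>r\<close> scales the sum
    \<open>y + z\<close>, not \<open>z\<close>.\<close>
  define z where "z = scale (of_real (r - 1)) y"
  have "y + z = scale (of_real r) y"
    by (simp add: z_def scale_left_diff_distrib)
  moreover have "spin_norm z < \<epsilon>"
  proof -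
    have "spin_norm z \<le> sqrt 2 * ((r - 1) * hilbert_norm y)"
      using spin_norm_le_hilbert_norm[of z] r(1)
      by (simp add: z_def hilbert_norm_scale del: of_real_diff)
    also have "\<dots> \<le> (r - 1) * (sqrt 2 * (hilbert_norm y + 1))"
      using r(1) by (simp add: algebra_simps)
    also have "\<dots> < \<eta> * (sqrt 2 * (hilbert_norm y + 1))"
      using r(2) pos by (intro mult_strict_right_mono) auto
    also have "\<dots> = \<epsilon>"
      using pos by (auto simp: \<eta>_def)
    finally show ?thesis .
  qed
  ultimately show ?thesis
    using r(3) invertible_operator_Bergmann[of x "y + z"] by auto
qed

end

theorem corollary3p8:
  fixes scale :: "complex \<Rightarrow> 'a::ab_group_add \<Rightarrow> 'a"
    and cinner :: "'a \<Rightarrow> 'a \<Rightarrow> complex"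
    and j :: "'a \<Rightarrow> 'a"
  assumes "spin_factor scale cinner j"
  shows "\<forall>x y. \<forall>\<epsilon>>0. \<exists>z. spin_factor.spin_norm cinner j z < \<epsilon> \<and>
           spin_factor.invertible_operator scale cinner j
             (spin_factor.Bergmann scale cinner j x (y + z))"
  using spin_factor.density_property[OF assms] by blast

end
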